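(* Let $G=(V,w,m)$ be a connected, locally finite weighted graph satisfying the curvature-dimension inequality $CD(K,\infty)$ for some $K>0$. Then $$\operatorname{diam}_d(G)\le \frac{2\operatorname{Deg}_{\max}}{K}.$$
   Context: A weighted graph $G=(V,w,m)$ consists of a countable set $V$, a symmetric function $w:V\times V\to[0,\infty)$ vanishing on the diagonal (edge weight), and a function $m:V\to(0,\infty)$ (vertex measure). It is locally finite if for every $x\in V$ there are only finitely many $y\in V$ with $w(x,y)>0$. It is connected if any two vertices are joined by a finite path $x_0,\dots,x_k$ with $w(x_{i-1},x_i)>0$ for all $i$. The Laplacian is $\Delta f(x)=\frac1{m(x)}\sum_y w(x,y)(f(y)-f(x))$ for $f:V\to\mathbb R$. Set $\operatorname{Deg}(x)=\frac{1}{m(x)}\sum_y w(x,y)$ and $\operatorname{Deg}_{\max}=\sup_{x\in V}\operatorname{Deg}(x)\in[0,\infty]$ (if $\operatorname{Deg}_{\max}=\infty$, the right-hand side of the claimed bound is $\infty$). For $f,g:V\to\mathbb R$ define $2\Gamma(f,g)=\Delta(fg)-f\Delta g-g\Delta f$ and $2\Gamma_2(f,g)=\Delta\Gamma(f,g)-\Gamma(f,\Delta g)-\Gamma(g,\Delta f)$, and write $\Gamma f=\Gamma(f,f)$, $\Gamma_2(f)=\Gamma_2(f,f)$. For $K\in\mathbb R$ and $n\in(0,\infty]$, $G$ satisfies $CD(K,n)$ if $\Gamma_2(f)\ge\frac1n(\Delta f)^2+K\,\Gamma f$ pointwise on $V$ for all $f:V\to\mathbb R$, with $\frac1\infty=0$;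 thus $CD(K,\infty)$ means $\Gamma_2(f)\ge K\,\Gamma f$ for all $f$. The combinatorial metric is $d(x,y)=\min\{k: \text{there exist } x=x_0,\dots,x_k=y \text{ with } w(x_{i-1},x_i)>0 \text{ for } i=1,\dots,k\}$, and $\operatorname{diam}_d(G)=\sup_{x,y\in V}d(x,y)$. *)

theory Defs
  imports "HOL-Analysis.Analysis"
begin

text \<open>
  The vertices form a set \<open>V\<close> inside an arbitrary type. All notions below depend only on the values
  of \<open>w\<close>, \<open>m\<close> and of the functions \<open>f\<close>, \<open>g\<close> at elements of \<open>V\<close>, so that quantifying
  over all \<open>f :: 'v \<Rightarrow> real\<close> amounts to quantifying over all real functions on \<open>V\<close>.
\<close>

definition weighted_graph ::
  "'v set \<Rightarrow> ('v \<Rightarrow> 'v \<Rightarrow> real) \<Rightarrow> ('v \<Rightarrow> real) \<Rightarrow> bool" where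
  "weighted_graph V w m \<longleftrightarrow>
     countable V \<and>
     (\<forall>x\<in>V. \<forall>y\<in>V. w x y \<ge> 0) \<and>
     (\<forall>x\<in>V. \<forall>y\<in>V. w x y = w y x) \<and>
     (\<forall>x\<in>V. w x x = 0) \<and>
     (\<forall>x\<in>V. m x > 0)"

definition locally_finite_graph :: "'v set \<Rightarrow> ('v \<Rightarrow> 'v \<Rightarrow> real) \<Rightarrow> bool" where
  "locally_finite_graph V w \<longleftrightarrow> (\<forall>x\<in>V. finite {y \<in> V. w x y > 0})"

definition graph_path ::
  "'v set \<Rightarrow> ('v \<Rightarrow> 'v \<Rightarrow> real) \<Rightarrow> 'v \<Rightarrow> 'v \<Rightarrow> nat \<Rightarrow> (nat \<Rightarrow> 'v) \<Rightarrow> bool" where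
  "graph_path V w x y k p \<longleftrightarrow>
     p 0 = x \<and> p k = y \<and> (\<forall>i\<le>k. p i \<in> V) \<and> (\<forall>i\<in>{1..k}. w (p (i - 1)) (p i) > 0)"

definition connected_graph :: "'v set \<Rightarrow> ('v \<Rightarrow> 'v \<Rightarrow> real) \<Rightarrow> bool" where
  "connected_graph V w \<longleftrightarrow> (\<forall>x\<in>V. \<forall>y\<in>V. \<exists>k p. graph_path V w x y k p)"

text \<open>
  On a locally finite graph the sums defining the Laplacian and the degree have only finitely many
  nonzero terms.
\<close>

definition laplacian ::
  "'v set \<Rightarrow> ('v \<Rightarrow> 'v \<Rightarrow> real) \<Rightarrow> ('v \<Rightarrow> real) \<Rightarrow> ('v \<Rightarrow> real) \<Rightarrow> 'v \<Rightarrow> real" where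
  "laplacian V w m f x = 1 / m x * (\<Sum>\<^sub>\<infinity>y\<in>V. w x y * (f y - f x))"

definition Deg ::
  "'v set \<Rightarrow> ('v \<Rightarrow> 'v \<Rightarrow> real) \<Rightarrow> ('v \<Rightarrow> real) \<Rightarrow> 'v \<Rightarrow> real" where
  "Deg V w m x = 1 / m x * (\<Sum>\<^sub>\<infinity>y\<in>V. w x y)"

definition Deg_max ::
  "'v set \<Rightarrow> ('v \<Rightarrow> 'v \<Rightarrow> real) \<Rightarrow> ('v \<Rightarrow> real) \<Rightarrow> ennreal" where
  "Deg_max V w m = (SUP x\<in>V. ennreal (Deg V w m x))"

definition Gam ::
  "'v set \<Rightarrow> ('v \<Rightarrow> 'v \<Rightarrow> real) \<Rightarrow> ('v \<Rightarrow> real) \<Rightarrow>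
     ('v \<Rightarrow> real) \<Rightarrow> ('v \<Rightarrow> real) \<Rightarrow> 'v \<Rightarrow> real" where
  "Gam V w m f g x =
     1 / 2 * (laplacian V w m (\<lambda>y. f y * g y) x
              - f x * laplacian V w m g x - g x * laplacian V w m f x)"

definition Gam2 ::
  "'v set \<Rightarrow> ('v \<Rightarrow> 'v \<Rightarrow> real) \<Rightarrow> ('v \<Rightarrow> real) \<Rightarrow>
     ('v \<Rightarrow> real) \<Rightarrow> ('v \<Rightarrow> real) \<Rightarrow> 'v \<Rightarrow> real" where
  "Gam2 V w m f g x =
     1 / 2 * (laplacian V w m (Gam V w m f g) x
              - Gam V w m f (laplacian V w m g) x - Gam V w m g (laplacian V w m f) x)"

text \<open>
  The dimension \<open>n\<close> ranges over \<open>(0, \<infinity>]\<close>; the convention \<open>1 / \<infinity> = 0\<close> is that of \<^typ>\<open>ereal\<close>.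
\<close>

definition CD ::
  "'v set \<Rightarrow> ('v \<Rightarrow> 'v \<Rightarrow> real) \<Rightarrow> ('v \<Rightarrow> real) \<Rightarrow> real \<Rightarrow> ereal \<Rightarrow> bool" where
  "CD V w m K n \<longleftrightarrow>
     (\<forall>f. \<forall>x\<in>V. Gam2 V w m f f x
        \<ge> real_of_ereal (1 / n) * (laplacian V w m f x)\<^sup>2 + K * Gam V w m f f x)"

text \<open>Meaningful only for vertices joined by a path, hence for all vertices of a connected graph.\<close>

definition graph_dist :: "'v set \<Rightarrow> ('v \<Rightarrow> 'v \<Rightarrow> real) \<Rightarrow> 'v \<Rightarrow> 'v \<Rightarrow> nat" where
  "graph_dist V w x y = (LEAST k. \<exists>p. graph_path V w x y k p)"

definition graph_diam :: "'v set \<Rightarrow> ('v \<Rightarrow> 'v \<Rightarrow> real) \<Rightarrow> ennreal" where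
  "graph_diam V w = (SUP x\<in>V. SUP y\<in>V. of_nat (graph_dist V w x y))"

end

theory Submission
  imports Defs
begin

text \<open>
  The function \<open>f = d(x\<^sub>0, \<sqdot>)\<close> satisfies \<open>\<Gamma> f \<le> D / 2\<close>, where \<open>D = Deg\<^sub>m\<^sub>a\<^sub>x\<close> may be assumed
  finite. Iterate the Euler step \<open>P = I + \<epsilon> \<Delta>\<close> of the heat flow. Expanding \<open>\<Gamma> (P f)\<close> and inserting
  the curvature inequality, the sup norm of \<open>\<Gamma>\<close> is multiplied in each step by at most
  \<open>1 - 2 \<epsilon> K + 4 D\<^sup>2 \<epsilon>\<^sup>2 \<le> s\<^sup>2\<close> with \<open>s = 1 - \<epsilon> K + 2 D\<^sup>2 \<epsilon>\<^sup>2\<close>; the second order error is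
  controlled because \<open>\<Delta>\<close> is bounded. Cauchy-Schwarz \<open>(\<Delta> f)\<^sup>2 \<le> 2 D \<Gamma> f\<close> then shows that the \<open>k\<close>-th step
  moves every value by at most \<open>\<epsilon> D s\<^sup>k\<close>, so the total displacement at every vertex is at most
  \<open>\<epsilon> D / (1 - s) = D / (K - 2 D\<^sup>2 \<epsilon>)\<close>. In the limit of the iteration \<open>\<Gamma>\<close> vanishes and differences
  between any two vertices tend to \<open>0\<close>, whence \<open>d(x\<^sub>0, y) \<le> 2 D / (K - 2 D\<^sup>2 \<epsilon>)\<close>; finally
  \<open>\<epsilon> \<rightarrow> 0\<close>.
\<close>

section \<open>Laplacian and carre du champ as finite sums over neighbours\<close>

definition neighbours :: "'v set \<Rightarrow> ('v \<Rightarrow> 'v \<Rightarrow> real) \<Rightarrow> 'v \<Rightarrow> 'v set" where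
  "neighbours V w x = {y \<in> V. w x y > 0}"

locale lf_weighted_graph =
  fixes V :: "'v set" and w :: "'v \<Rightarrow> 'v \<Rightarrow> real" and m :: "'v \<Rightarrow> real"
  assumes weighted: "weighted_graph V w m"
    and locally_finite: "locally_finite_graph V w"
begin

abbreviation "N \<equiv> neighbours V w"
abbreviation "\<Delta> \<equiv> laplacian V w m"
abbreviation "\<Gamma> \<equiv> Gam V w m"

lemma m_pos: "x \<in> V \<Longrightarrow> m x > 0"
  using weighted by (simp add: weighted_graph_def)

lemma w_nonneg: "x \<in> V \<Longrightarrow> y \<in> V \<Longrightarrow> w x y \<ge> 0"
  using weighted by (simp add: weighted_graph_def)

lemma w_sym: "x \<in> V \<Longrightarrow> y \<in> V \<Longrightarrow> w x y = w y x"
  using weighted by (auto simp: weighted_graph_def)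

lemma finite_neighbours: "x \<in> V \<Longrightarrow> finite (N x)"
  using locally_finite by (simp add: locally_finite_graph_def neighbours_def)

lemma neighboursD: "y \<in> N x \<Longrightarrow> y \<in> V" "y \<in> N x \<Longrightarrow> w x y > 0"
  by (auto simp: neighbours_def)

text \<open>Weights are nonnegative, so a vertex outside \<open>N x\<close> has weight exactly 0 and
  contributes nothing.\<close>

lemma infsum_neighbours:
  assumes "x \<in> V"
  shows "(\<Sum>\<^sub>\<infinity>y\<in>V. w x y * g y) = (\<Sum>y\<in>N x. w x y * g y)"
proof -
  have "(\<Sum>\<^sub>\<infinity>y\<in>V. w x y * g y) = (\<Sum>\<^sub>\<infinity>y\<in>N x. w x y * g y)"
  proof (rule infsum_cong_neutral)
    fix y assume "y \<in> V - N x"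
    then have "w x y = 0"
      using w_nonneg[OF assms, of y] by (auto simp: neighbours_def)
    then show "w x y * g y = 0" by simp
  qed (auto simp: neighbours_def)
  then show ?thesis
    using assms by (simp add: finite_neighbours)
qed

lemma laplacian_eq: "x \<in> V \<Longrightarrow> \<Delta> f x = (\<Sum>y\<in>N x. w x y * (f y - f x)) / m x"
  by (simp add: laplacian_def infsum_neighbours)

lemma Deg_eq: "x \<in> V \<Longrightarrow> Deg V w m x = (\<Sum>y\<in>N x. w x y) / m x"
  using infsum_neighbours[of x "\<lambda>_. 1"] by (simp add: Deg_def)

lemma Deg_nonneg: "x \<in> V \<Longrightarrow> 0 \<le> Deg V w m x"
  by (auto simp: Deg_eq intro!: divide_nonneg_pos sum_nonneg m_pos less_imp_le[OF neighboursD(2)])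

text \<open>Under the weights, fg(y) - fg(x) - f(x)(g(y) - g(x)) - g(x)(f(y) - f(x)) factors into
  the product of the two increments. For f = g this exhibits \<Gamma> as a weighted sum of
  squares.\<close>

lemma Gam_eq:
  assumes "x \<in> V"
  shows "\<Gamma> f g x = (\<Sum>y\<in>N x. w x y * ((f y - f x) * (g y - g x))) / (2 * m x)"
proof -
  have "(\<Sum>y\<in>N x. w x y * ((f y - f x) * (g y - g x)))
      = (\<Sum>y\<in>N x. w x y * (f y * g y - f x * g x) - f x * (w x y * (g y - g x))
          - g x * (w x y * (f y - f x)))"
    by (intro sum.cong) (auto simp: algebra_simps)
  also have "\<dots> = (\<Sum>y\<in>N x. w x y * (f y * g y - f x * g x))
      - f x * (\<Sum>y\<in>N x. w x y * (g y - g x)) - g x * (\<Sum>y\<in>N x. w x y * (f y - f x))"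
    by (simp only: sum_subtractf sum_distrib_left)
  finally show ?thesis
    unfolding Gam_def laplacian_eq[OF assms] by (simp only:) (simp add: diff_divide_distrib)
qed

lemma Gam_self_eq:
  "x \<in> V \<Longrightarrow> \<Gamma> f f x = (\<Sum>y\<in>N x. w x y * (f y - f x)\<^sup>2) / (2 * m x)"
  by (simp add: Gam_eq power2_eq_square)

lemma Gam_nonneg: "x \<in> V \<Longrightarrow> 0 \<le> \<Gamma> f f x"
  by (auto simp: Gam_self_eq less_imp_le[OF m_pos] less_imp_le[OF neighboursD(2)]
      intro!: divide_nonneg_nonneg sum_nonneg mult_nonneg_nonneg)

lemma Gam_add_scaled:
  assumes "x \<in> V"
  shows "\<Gamma> (\<lambda>y. f y + e * g y) (\<lambda>y. f y + e * g y) x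
       = \<Gamma> f f x + 2 * e * \<Gamma> f g x + e\<^sup>2 * \<Gamma> g g x"
proof -
  have "(\<Sum>y\<in>N x. w x y * ((f y + e * g y - (f x + e * g x)) * (f y + e * g y - (f x + e * g x))))
      = (\<Sum>y\<in>N x. w x y * ((f y - f x) * (f y - f x)) + 2 * e * (w x y * ((f y - f x) * (g y - g x)))
          + e\<^sup>2 * (w x y * ((g y - g x) * (g y - g x))))"
    by (intro sum.cong) (auto simp: algebra_simps power2_eq_square)
  also have "\<dots> = (\<Sum>y\<in>N x. w x y * ((f y - f x) * (f y - f x)))
      + 2 * e * (\<Sum>y\<in>N x. w x y * ((f y - f x) * (g y - g x)))
      + e\<^sup>2 * (\<Sum>y\<in>N x. w x y * ((g y - g x) * (g y - g x)))"
    by (simp only: sum.distrib sum_distrib_left)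
  finally show ?thesis
    by (simp add: Gam_eq assms add_divide_distrib)
qed

section \<open>Pointwise estimates for \<Delta> and \<Gamma>\<close>

lemma laplacian_le:
  assumes "x \<in> V" and "\<And>y. y \<in> V \<Longrightarrow> f y \<le> C"
  shows "\<Delta> f x \<le> Deg V w m x * (C - f x)"
proof -
  have "(\<Sum>y\<in>N x. w x y * (f y - f x)) \<le> (\<Sum>y\<in>N x. w x y * (C - f x))"
    using assms(2) by (intro sum_mono mult_left_mono) (auto dest: neighboursD)
  then show ?thesis
    using m_pos[OF assms(1)]
    by (simp add: laplacian_eq Deg_eq assms(1) divide_right_mono sum_distrib_right)
qed

lemma laplacian_square_le:
  assumes "x \<in> V"
  shows "(\<Delta> f x)\<^sup>2 \<le> 2 * Deg V w m x * \<Gamma> f f x"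
proof -
  \<comment> \<open>Splitting w as sqrt w * sqrt w makes one factor sum to the degree and the other
    to \<Gamma>, up to normalisation.\<close>
  have "(\<Sum>y\<in>N x. sqrt (w x y) * (sqrt (w x y) * (f y - f x)))\<^sup>2
      \<le> (\<Sum>y\<in>N x. (sqrt (w x y))\<^sup>2) * (\<Sum>y\<in>N x. (sqrt (w x y) * (f y - f x))\<^sup>2)"
    by (rule Cauchy_Schwarz_ineq_sum)
  also have "(\<Sum>y\<in>N x. sqrt (w x y) * (sqrt (w x y) * (f y - f x)))
      = (\<Sum>y\<in>N x. w x y * (f y - f x))"
    by (intro sum.cong) (auto dest: neighboursD(2) simp flip: mult.assoc)
  also have "(\<Sum>y\<in>N x. (sqrt (w x y))\<^sup>2) = (\<Sum>y\<in>N x. w x y)"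
    by (intro sum.cong) (auto dest: neighboursD(2))
  also have "(\<Sum>y\<in>N x. (sqrt (w x y) * (f y - f x))\<^sup>2) = (\<Sum>y\<in>N x. w x y * (f y - f x)\<^sup>2)"
    by (intro sum.cong) (auto dest: neighboursD(2) simp: power_mult_distrib)
  finally have "(\<Sum>y\<in>N x. w x y * (f y - f x))\<^sup>2 / (m x)\<^sup>2
      \<le> ((\<Sum>y\<in>N x. w x y) * (\<Sum>y\<in>N x. w x y * (f y - f x)\<^sup>2)) / (m x)\<^sup>2"
    by (simp add: divide_right_mono)
  then show ?thesis
    by (simp add: laplacian_eq Deg_eq Gam_self_eq assms power_divide power2_eq_square)
qed

lemma Gam_le_of_difference:
  assumes "x \<in> V" and "\<And>y. y \<in> N x \<Longrightarrow> (f y - f x)\<^sup>2 \<le> C"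
  shows "\<Gamma> f f x \<le> Deg V w m x * C / 2"
proof -
  have "(\<Sum>y\<in>N x. w x y * (f y - f x)\<^sup>2) \<le> (\<Sum>y\<in>N x. w x y * C)"
    using assms(2) by (intro sum_mono mult_left_mono) (auto dest: neighboursD)
  also have "\<dots> = (\<Sum>y\<in>N x. w x y) * C"
    by (simp add: sum_distrib_right)
  finally have "(\<Sum>y\<in>N x. w x y * (f y - f x)\<^sup>2) / (2 * m x) \<le> (\<Sum>y\<in>N x. w x y) * C / (2 * m x)"
    using m_pos[OF assms(1)] by (intro divide_right_mono) auto
  then show ?thesis
    by (simp add: Gam_self_eq Deg_eq assms(1) mult_ac)
qed

text \<open>One term of a sum of nonnegative terms is at most the sum. This turns decay of \<Gamma>
  into decay of the increment along an edge.\<close>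

lemma difference_le_Gam:
  assumes "x \<in> V" and "y \<in> N x"
  shows "(f y - f x)\<^sup>2 \<le> 2 * m x / w x y * \<Gamma> f f x"
proof -
  have "w x y * (f y - f x)\<^sup>2 \<le> (\<Sum>z\<in>N x. w x z * (f z - f x)\<^sup>2)"
    using assms by (intro member_le_sum) (auto simp: finite_neighbours dest: neighboursD)
  moreover have "w x y > 0" "m x > 0"
    using assms by (auto simp: m_pos neighboursD)
  ultimately show ?thesis
    by (simp add: Gam_self_eq assms(1) field_simps)
qed

section \<open>Combinatorial distance\<close>

lemma graph_path_snoc:
  assumes "graph_path V w x y k p" and "z \<in> N y"
  shows "graph_path V w x z (Suc k) (p(Suc k := z))"
  using assms by (auto simp: graph_path_def neighbours_def le_Suc_eq)

lemma graph_dist_neighbour_le: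
  assumes "connected_graph V w" and "x \<in> V" "y \<in> V" and "z \<in> N y"
  shows "graph_dist V w x z \<le> Suc (graph_dist V w x y)"
proof -
  have "\<exists>k p. graph_path V w x y k p"
    using assms by (simp add: connected_graph_def)
  then have "\<exists>p. graph_path V w x y (graph_dist V w x y) p"
    unfolding graph_dist_def by (rule LeastI_ex)
  then have "\<exists>p. graph_path V w x z (Suc (graph_dist V w x y)) p"
    using graph_path_snoc assms(4) by blast
  then show ?thesis
    unfolding graph_dist_def[of V w x z] by (rule Least_le)
qed

lemma graph_dist_self: "x \<in> V \<Longrightarrow> graph_dist V w x x = 0"
  unfolding graph_dist_def by (rule Least_eq_0) (auto simp: graph_path_def intro!: exI[of _ "\<lambda>_. x"])

text \<open>Distance from \<open>x0\<close> changes by at most 1 along an edge; symmetry of w gives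
  this in both directions.\<close>

lemma Gam_graph_dist_le:
  assumes "connected_graph V w" and "x0 \<in> V" and "x \<in> V"
  shows "\<Gamma> (\<lambda>y. real (graph_dist V w x0 y)) (\<lambda>y. real (graph_dist V w x0 y)) x
    \<le> Deg V w m x / 2"
proof -
  let ?d = "\<lambda>y. real (graph_dist V w x0 y)"
  have "(?d y - ?d x)\<^sup>2 \<le> 1" if y: "y \<in> N x" for y
  proof -
    have "y \<in> V" "x \<in> N y"
      using y assms(3) w_sym by (auto simp: neighbours_def)
    then have "\<bar>?d y - ?d x\<bar> \<le> 1"
      using graph_dist_neighbour_le[OF assms y] graph_dist_neighbour_le[OF assms(1,2), of y x]
      by linarith
    then show ?thesis
      by (simp add: abs_square_le_1)
  qed
  from Gam_le_of_difference[of x ?d 1, OF assms(3) this] show ?thesis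
    by simp
qed

end

section \<open>Curvature and the Euler step of the heat flow\<close>

locale curved_graph = lf_weighted_graph +
  fixes K D :: real
  assumes curvature: "CD V w m K \<infinity>" and K_pos: "K > 0"
    and Deg_le: "\<And>x. x \<in> V \<Longrightarrow> Deg V w m x \<le> D"
begin

text \<open>Twice \<open>Gam2\<close> at (f, f) is \<Delta>\<Gamma>f - 2\<Gamma>(f, \<Delta>f), and
  1/\<infinity> = 0 removes the dimension term. The left side is the coefficient of e in \<Gamma>(f
  + e \<Delta>f).\<close>

lemma curvature_ineq:
  assumes "x \<in> V"
  shows "2 * \<Gamma> f (\<Delta> f) x \<le> \<Delta> (\<Gamma> f f) x - 2 * K * \<Gamma> f f x"
proof -
  have "Gam2 V w m f f x \<ge> K * \<Gamma> f f x"
    using curvature assms by (auto simp: CD_def)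
  then show ?thesis
    by (simp add: Gam2_def)
qed

lemma laplacian_square_bound:
  assumes "x \<in> V" and "\<Gamma> f f x \<le> C"
  shows "(\<Delta> f x)\<^sup>2 \<le> 2 * D * C"
proof -
  have "(\<Delta> f x)\<^sup>2 \<le> 2 * (Deg V w m x * \<Gamma> f f x)"
    using laplacian_square_le[OF assms(1), of f] by (simp add: mult.assoc)
  also have "\<dots> \<le> 2 * (D * C)"
    using assms Deg_le[OF assms(1)] Deg_nonneg[OF assms(1)] Gam_nonneg[OF assms(1), of f]
    by (intro mult_left_mono mult_mono) auto
  finally show ?thesis
    by simp
qed

text \<open>Squared values of \<Delta>f are at most 2DC, so squared increments are at most 2(2DC +
  2DC) = 8DC; degree at most D and the factor 1/2 in \<Gamma> give 4D^2 C.\<close>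

lemma Gam_laplacian_bound:
  assumes "x \<in> V" and C: "\<And>y. y \<in> V \<Longrightarrow> \<Gamma> f f y \<le> C"
  shows "\<Gamma> (\<Delta> f) (\<Delta> f) x \<le> 4 * D\<^sup>2 * C"
proof -
  have "0 \<le> C"
    using C[OF assms(1)] Gam_nonneg[OF assms(1), of f] by linarith
  have D: "0 \<le> D"
    using Deg_nonneg[OF assms(1)] Deg_le[OF assms(1)] by linarith
  have "(\<Delta> f y - \<Delta> f x)\<^sup>2 \<le> 8 * D * C" if "y \<in> N x" for y
  proof -
    have "(\<Delta> f y - \<Delta> f x)\<^sup>2 \<le> 2 * (\<Delta> f y)\<^sup>2 + 2 * (\<Delta> f x)\<^sup>2"
      using zero_le_power2[of "\<Delta> f y + \<Delta> f x"] by (simp add: power2_eq_square algebra_simps)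
    moreover have "(\<Delta> f y)\<^sup>2 \<le> 2 * D * C" "(\<Delta> f x)\<^sup>2 \<le> 2 * D * C"
      using that assms by (auto intro!: laplacian_square_bound dest: neighboursD)
    ultimately show ?thesis
      by linarith
  qed
  then have "\<Gamma> (\<Delta> f) (\<Delta> f) x \<le> Deg V w m x * (8 * D * C) / 2"
    by (rule Gam_le_of_difference[OF assms(1)])
  also have "\<dots> \<le> D * (8 * D * C) / 2"
    using D \<open>0 \<le> C\<close> Deg_le[OF assms(1)] by (intro divide_right_mono mult_right_mono) auto
  finally show ?thesis
    by (simp add: power2_eq_square mult_ac)
qed

definition euler_step :: "real \<Rightarrow> ('a \<Rightarrow> real) \<Rightarrow> 'a \<Rightarrow> real" where
  "euler_step e f x = f x + e * \<Delta> f x"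

lemma Gam_euler_step_le:
  assumes x: "x \<in> V" and C: "\<And>y. y \<in> V \<Longrightarrow> \<Gamma> f f y \<le> C"
    and e: "0 \<le> e" "e * (D + 2 * K) \<le> 1"
  shows "\<Gamma> (euler_step e f) (euler_step e f) x \<le> (1 - 2 * e * K + 4 * D\<^sup>2 * e\<^sup>2) * C"
proof -
  define G where "G = \<Gamma> f f x"
  define d where "d = Deg V w m x"
  have "euler_step e f = (\<lambda>y. f y + e * \<Delta> f y)"
    by (simp add: euler_step_def fun_eq_iff)
  then have "\<Gamma> (euler_step e f) (euler_step e f) x
      = G + e * (2 * \<Gamma> f (\<Delta> f) x) + e\<^sup>2 * \<Gamma> (\<Delta> f) (\<Delta> f) x"
    by (simp add: Gam_add_scaled[OF x] G_def)
  \<comment> \<open>Curvature bounds the first-order term by \<Delta>\<Gamma>f - 2KG, and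
    \<Delta>\<Gamma>f is at most d(C - G) because C bounds \<Gamma>f everywhere.\<close>
  also have "\<dots> \<le> G + e * (d * (C - G) - 2 * K * G) + e\<^sup>2 * (4 * D\<^sup>2 * C)"
  proof (intro add_mono mult_left_mono order_refl)
    show "2 * \<Gamma> f (\<Delta> f) x \<le> d * (C - G) - 2 * K * G"
      using curvature_ineq[OF x, of f] laplacian_le[of x "\<Gamma> f f", OF x C]
      unfolding G_def d_def by linarith
  qed (use e(1) Gam_laplacian_bound[OF x C] in auto)
  also have "\<dots> = (1 - e * d - 2 * e * K) * G + e * d * C + 4 * D\<^sup>2 * e\<^sup>2 * C"
    by (simp add: algebra_simps)
  \<comment> \<open>Smallness of e keeps the coefficient of G nonnegative, so G may be replaced by
    C; the two terms in \<open>e * d\<close> then cancel.\<close>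
  also have "\<dots> \<le> (1 - e * d - 2 * e * K) * C + e * d * C + 4 * D\<^sup>2 * e\<^sup>2 * C"
  proof (intro add_right_mono mult_right_mono mult_left_mono)
    have "e * d \<le> e * D"
      using e(1) Deg_le[OF x] by (simp add: d_def mult_left_mono)
    then show "0 \<le> 1 - e * d - 2 * e * K"
      using e(2) by (simp add: algebra_simps)
    show "G \<le> C"
      using C[OF x] by (simp add: G_def)
  qed
  finally show ?thesis
    by (simp add: algebra_simps)
qed

text \<open>With u = -eK + 2D^2 e^2 this is 1 + u, whose square dominates the step factor 1 + 2u. It
  bounds the decay of the square root of \<Gamma> without taking a root.\<close>

definition contraction :: "real \<Rightarrow> real" where
  "contraction e = 1 - e * K + 2 * D\<^sup>2 * e\<^sup>2"

lemma Gam_euler_iterate_le: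
  assumes f: "\<And>y. y \<in> V \<Longrightarrow> \<Gamma> f f y \<le> D / 2" and "x \<in> V"
    and e: "0 \<le> e" "e * (D + 2 * K) \<le> 1"
  shows "\<Gamma> ((euler_step e ^^ k) f) ((euler_step e ^^ k) f) x \<le> D / 2 * (contraction e ^ k)\<^sup>2"
  using \<open>x \<in> V\<close>
\<comment> \<open>The vertex is generalised because the step estimate at x needs the previous bound
  at every vertex.\<close>
proof (induction k arbitrary: x)
  case 0
  show ?case
    using f[OF 0] by simp
next
  case (Suc k)
  have "D \<ge> 0"
    using Deg_nonneg[OF Suc.prems] Deg_le[OF Suc.prems] by linarith
  have "\<Gamma> ((euler_step e ^^ Suc k) f) ((euler_step e ^^ Suc k) f) x
      \<le> (1 - 2 * e * K + 4 * D\<^sup>2 * e\<^sup>2) * (D / 2 * (contraction e ^ k)\<^sup>2)"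
    using Gam_euler_step_le[OF Suc.prems Suc.IH e] by simp
  also have "\<dots> \<le> (contraction e)\<^sup>2 * (D / 2 * (contraction e ^ k)\<^sup>2)"
  proof (rule mult_right_mono)
    have "(contraction e)\<^sup>2
        = 1 - 2 * e * K + 4 * D\<^sup>2 * e\<^sup>2 + (2 * D\<^sup>2 * e\<^sup>2 - e * K)\<^sup>2"
      by (simp add: contraction_def power2_eq_square algebra_simps)
    then show "1 - 2 * e * K + 4 * D\<^sup>2 * e\<^sup>2 \<le> (contraction e)\<^sup>2"
      by simp
  qed (use \<open>D \<ge> 0\<close> in simp)
  finally show ?case
    by (simp add: power_mult_distrib mult_ac)
qed

section \<open>Displacement and limit of the iterates\<close>

lemma difference_bound:
  assumes f: "\<And>z. z \<in> V \<Longrightarrow> \<Gamma> f f z \<le> D / 2"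
    and path: "graph_path V w x y n p"
    and e: "0 < e" "e * (D + 2 * K) \<le> 1" "2 * D\<^sup>2 * e < K"
  shows "f y - f x \<le> 2 * D / (K - 2 * D\<^sup>2 * e)"
proof -
  define F where "F k = (euler_step e ^^ k) f" for k
  define s where "s = contraction e"
  have V: "x \<in> V" "y \<in> V"
    using path by (auto simp: graph_path_def)
  have D: "D \<ge> 0"
    using Deg_nonneg[OF V(1)] Deg_le[OF V(1)] by linarith
  \<comment> \<open>This factor e cancels the step size in the geometric series below, so the total
    displacement stays bounded as e tends to 0.\<close>
  have s1: "1 - s = e * (K - 2 * D\<^sup>2 * e)"
    by (simp add: s_def contraction_def algebra_simps power2_eq_square)
  then have "s < 1"
    using e by (metis diff_gt_0_iff_gt mult_pos_pos)
  have "e * K \<le> e * (D + 2 * K)"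
    using e(1) D K_pos by (intro mult_left_mono) auto
  then have "s \<ge> 0"
    using e(2) by (simp add: s_def contraction_def)
  have Gam_F: "\<Gamma> (F k) (F k) z \<le> D / 2 * (s ^ k)\<^sup>2" if "z \<in> V" for k z
    unfolding F_def s_def using f that e by (intro Gam_euler_iterate_le) auto

  have step: "\<bar>F (Suc k) z - F k z\<bar> \<le> e * D * s ^ k" if "z \<in> V" for k z
  proof -
    \<comment> \<open>The constants combine to the perfect square 2D * (D/2) = D^2.\<close>
    have "(\<Delta> (F k) z)\<^sup>2 \<le> (D * s ^ k)\<^sup>2"
      using laplacian_square_bound[OF that Gam_F[OF that]] by (simp add: power2_eq_square mult_ac)
    then have "\<bar>\<Delta> (F k) z\<bar> \<le> D * s ^ k"
      using D \<open>s \<ge> 0\<close> by (simp add: abs_le_square_iff[symmetric])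
    then show ?thesis
      using e(1) by (simp add: F_def euler_step_def abs_mult)
  qed
  have displacement: "\<bar>F k z - f z\<bar> \<le> D / (K - 2 * D\<^sup>2 * e)" if "z \<in> V" for k z
  proof -
    have "F k z - f z = (\<Sum>i<k. F (Suc i) z - F i z)"
      using sum_lessThan_telescope[of "\<lambda>i. F i z" k] by (simp add: F_def)
    also have "\<bar>\<dots>\<bar> \<le> (\<Sum>i<k. \<bar>F (Suc i) z - F i z\<bar>)"
      by (rule sum_abs)
    also have "\<dots> \<le> (\<Sum>i<k. e * D * s ^ i)"
      using step[OF that] by (intro sum_mono) auto
    also have "\<dots> = e * D * ((1 - s ^ k) / (1 - s))"
      using \<open>s < 1\<close> by (simp add: sum_distrib_left[symmetric] sum_gp_strict)
    also have "\<dots> \<le> e * D * (1 / (1 - s))"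
      using \<open>s < 1\<close> \<open>s \<ge> 0\<close> e(1) D by (intro mult_left_mono divide_right_mono) auto
    also have "\<dots> = D / (K - 2 * D\<^sup>2 * e)"
      using e(1) by (simp add: s1)
    finally show ?thesis .
  qed

  have s_lim: "(\<lambda>k. s ^ k) \<longlonglongrightarrow> 0"
    using \<open>s < 1\<close> \<open>s \<ge> 0\<close> by (intro LIMSEQ_power_zero) auto
  have edge: "(\<lambda>k. F k b - F k a) \<longlonglongrightarrow> 0" if a: "a \<in> V" and b: "b \<in> N a" for a b
  proof -
    have bound: "(F k b - F k a)\<^sup>2 \<le> 2 * m a / w a b * (D / 2 * (s ^ k)\<^sup>2)" for k
    proof -
      have "2 * m a / w a b * \<Gamma> (F k) (F k) a \<le> 2 * m a / w a b * (D / 2 * (s ^ k)\<^sup>2)"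
        using Gam_F[OF a] m_pos[OF a] neighboursD(2)[OF b] by (intro mult_left_mono) auto
      with difference_le_Gam[OF a b, of "F k"] show ?thesis
        by linarith
    qed
    have "(\<lambda>k. 2 * m a / w a b * (D / 2 * (s ^ k)\<^sup>2)) \<longlonglongrightarrow> 2 * m a / w a b * (D / 2 * 0\<^sup>2)"
      by (intro tendsto_intros s_lim)
    then have lim: "(\<lambda>k. 2 * m a / w a b * (D / 2 * (s ^ k)\<^sup>2)) \<longlonglongrightarrow> 0"
      by (simp only: power_zero_numeral mult_zero_right)
    have "(\<lambda>k. (F k b - F k a)\<^sup>2) \<longlonglongrightarrow> 0"
      by (rule tendsto_sandwich[OF always_eventually always_eventually tendsto_const lim])
        (simp, intro allI bound)
    then show ?thesis
      by (simp add: power_tendsto_0_iff)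
  qed
  \<comment> \<open>The rate along an edge depends on m/w there, but only finitely many edges of the
    path are added up.\<close>
  have "(\<lambda>k. F k (p i) - F k x) \<longlonglongrightarrow> 0" if "i \<le> n" for i
    using that
  proof (induction i)
    case 0
    then show ?case
      using path by (simp add: graph_path_def)
  next
    case (Suc i)
    have "p i \<in> V" "p (Suc i) \<in> N (p i)"
      using path Suc.prems by (auto simp: graph_path_def neighbours_def dest: bspec[of _ _ "Suc i"])
    from tendsto_add[OF edge[OF this] Suc.IH] Suc.prems show ?case
      by simp
  qed
  from this[of n] have lim: "(\<lambda>k. F k y - F k x) \<longlonglongrightarrow> 0"
    using path by (simp add: graph_path_def)
  \<comment> \<open>Displacement is paid at both ends, whence the factor 2; the bound is uniform in
    k and survives the limit.\<close>
  have "f y - f x - 2 * D / (K - 2 * D\<^sup>2 * e) \<le> F k y - F k x" for k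
    using displacement[OF V(1), of k] displacement[OF V(2), of k] by (simp add: abs_le_iff)
  then have "f y - f x - 2 * D / (K - 2 * D\<^sup>2 * e) \<le> 0"
    by (intro LIMSEQ_le_const[OF lim]) auto
  then show ?thesis
    by simp
qed

section \<open>Diameter bound as the step size tends to 0\<close>

lemma graph_dist_le:
  assumes conn: "connected_graph V w" and "x \<in> V" "y \<in> V"
  shows "real (graph_dist V w x y) \<le> 2 * D / K"
proof -
  define f where "f z = real (graph_dist V w x z)" for z
  obtain n p where path: "graph_path V w x y n p"
    using assms unfolding connected_graph_def by blast
  have f: "\<Gamma> f f z \<le> D / 2" if "z \<in> V" for z
    using Gam_graph_dist_le[OF conn \<open>x \<in> V\<close> that] Deg_le[OF that] by (simp add: f_def[abs_def])
  \<comment> \<open>All conditions on e hold for small positive e, so a right-hand limit at 0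
    removes the error 2D^2 e.\<close>
  have "\<forall>\<^sub>F e in at_right 0. e * (D + 2 * K) < 1"
    by (rule order_tendstoD(2)[of _ "0 * (D + 2 * K)"], intro tendsto_intros) simp
  moreover have "\<forall>\<^sub>F e in at_right 0. 2 * D\<^sup>2 * e < K"
    by (rule order_tendstoD(2)[of _ "2 * D\<^sup>2 * 0"], intro tendsto_intros) (simp add: K_pos)
  moreover have "\<forall>\<^sub>F e::real in at_right 0. 0 < e"
    by (simp add: eventually_at_right_less)
  ultimately have "\<forall>\<^sub>F e in at_right 0. f y - f x \<le> 2 * D / (K - 2 * D\<^sup>2 * e)"
    by eventually_elim (use difference_bound[OF f path] in auto)
  moreover have "((\<lambda>e. 2 * D / (K - 2 * D\<^sup>2 * e)) \<longlongrightarrow> 2 * D / (K - 2 * D\<^sup>2 * 0)) (at_right 0)"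
    using K_pos by (intro tendsto_intros) auto
  ultimately have "f y - f x \<le> 2 * D / (K - 2 * D\<^sup>2 * 0)"
    by (intro tendsto_lowerbound) auto
  then show ?thesis
    using \<open>x \<in> V\<close> by (simp add: f_def graph_dist_self)
qed

end

theorem corollary2p2:
  fixes V :: "'v set" and w :: "'v \<Rightarrow> 'v \<Rightarrow> real" and m :: "'v \<Rightarrow> real" and K :: real
  assumes "weighted_graph V w m"
    and "connected_graph V w"
    and "locally_finite_graph V w"
    and "K > 0"
    and "CD V w m K \<infinity>"
  shows "graph_diam V w \<le> 2 * Deg_max V w m / ennreal K"
proof (cases "Deg_max V w m")
  \<comment> \<open>The right-hand side is infinite here, since \<open>ennreal K\<close> is
    finite.\<close>
  case top
  then show ?thesis
    using assms(4) by (simp add: ennreal_mult_top ennreal_top_divide)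
next
  case (real D)
  have "Deg V w m x \<le> D" if "x \<in> V" for x
  proof -
    have "ennreal (Deg V w m x) \<le> ennreal D"
      using that unfolding real(2)[symmetric] Deg_max_def by (rule SUP_upper)
    then show ?thesis
      using real(1) by simp
  qed
  then interpret curved_graph V w m K D
    using assms by unfold_locales auto
  have "of_nat (graph_dist V w x y) \<le> 2 * Deg_max V w m / ennreal K" if "x \<in> V" "y \<in> V" for x y
  proof -
    have "ennreal (real (graph_dist V w x y)) \<le> ennreal (2 * D / K)"
      by (rule ennreal_leI) (rule graph_dist_le[OF assms(2) that])
    also have "\<dots> = 2 * Deg_max V w m / ennreal K"
      using real assms(4) by (simp add: divide_ennreal[symmetric] ennreal_mult)
    finally show ?thesis
      by (simp add: ennreal_of_nat_eq_real_of_nat)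
  qed
  then show ?thesis
    unfolding graph_diam_def by (intro SUP_least)
qed

end
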